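(* Let $(A,\ast,\alpha)$ be a Hom-Jacobi-Jordan algebra over a field $\mathbb{K}$, let $k,s$ be nonnegative integers, let $D_1$ be an $\alpha^k$-derivation of $(A,\ast,\alpha)$ and let $D_2$ be an $\alpha^s$-derivation of $(A,\ast,\alpha)$. Then the anti-commutator $\{D_1,D_2\}:=D_1D_2+D_2D_1$ is an $\alpha^{k+s}$-derivation of $(A,\ast,\alpha)$ if and only if for all $u,v\in A$ $$(\alpha^s\circ D_1)(u)\ast(\alpha^k\circ D_2)(v)+(\alpha^k\circ D_2)(u)\ast(\alpha^s\circ D_1)(v)=0.$$
   Context: All vector spaces are over a ground field $\mathbb{K}$. A Hom-Jacobi-Jordan algebra is a triple $(A,\ast,\alpha)$ where $A$ is a vector space, $\ast:A\otimes A\to A$ and $\alpha:A\to A$ are linear, such that for all $x,y,z\in A$: $\alpha(x\ast y)=\alpha(x)\ast\alpha(y)$ (multiplicativity), $x\ast y=y\ast x$, and $(x\ast y)\ast\alpha(z)+(y\ast z)\ast\alpha(x)+(z\ast x)\ast\alpha(y)=0$. For a nonnegative integer $k$, $\alpha^k$ denotes the $k$-fold composition of $\alpha$ with itself ($\alpha^0=\mathrm{Id}$). A linear map $D:A\to A$ is an $\alpha^k$-derivation of $(A,\ast,\alpha)$ if $D\circ\alpha=\alpha\circ D$ and $D(u\ast v)=D(u)\ast\alpha^k(v)+\alpha^k(u)\ast D(v)$ for all $u,v\in A$. Products such as $D_1D_2$ denote composition of maps.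
   Formalization: The ground field is additionally assumed to have characteristic different from 2; in characteristic 2 the "only if" direction fails (e.g. K[x,y]/(x²,y²), α = 0, k = s = 0, D1 = ∂/∂x, D2 = ∂/∂y). *)

theory Defs
  imports Complex_Main
begin

text \<open>
  The underlying vector space is the whole type \<open>'a\<close>, with scalar multiplication \<open>scale\<close> over the
  field \<open>'k\<close>.  A linear map out of \<open>A \<otimes> A\<close> is given as a bilinear map, i.e. one that is
  linear in each argument.
\<close>

locale hom_jacobi_jordan_algebra = vector_space scale
  for scale :: "'k::field \<Rightarrow> 'a::ab_group_add \<Rightarrow> 'a" +
  fixes hmul :: "'a \<Rightarrow> 'a \<Rightarrow> 'a" (infixl "\<star>" 70)
    and \<alpha> :: "'a \<Rightarrow> 'a"
  assumes linear_prod_right: "\<And>x. Vector_Spaces.linear scale scale (\<lambda>y. x \<star> y)"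
    and linear_prod_left: "\<And>y. Vector_Spaces.linear scale scale (\<lambda>x. x \<star> y)"
    and linear_twist: "Vector_Spaces.linear scale scale \<alpha>"
    and multiplicative: "\<And>x y. \<alpha> (x \<star> y) = \<alpha> x \<star> \<alpha> y"
    and commutative: "\<And>x y. x \<star> y = y \<star> x"
    and hom_jacobi: "\<And>x y z. (x \<star> y) \<star> \<alpha> z + (y \<star> z) \<star> \<alpha> x + (z \<star> x) \<star> \<alpha> y = 0"

definition twisted_derivation ::
  "('k::field \<Rightarrow> 'a::ab_group_add \<Rightarrow> 'a) \<Rightarrow> ('a \<Rightarrow> 'a \<Rightarrow> 'a) \<Rightarrow> ('a \<Rightarrow> 'a) \<Rightarrow> nat \<Rightarrow> ('a \<Rightarrow> 'a) \<Rightarrow> bool"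
  where "twisted_derivation scale hmul \<alpha> k D \<longleftrightarrow>
    Vector_Spaces.linear scale scale D \<and>
    D \<circ> \<alpha> = \<alpha> \<circ> D \<and>
    (\<forall>u v. D (hmul u v) = hmul (D u) ((\<alpha> ^^ k) v) + hmul ((\<alpha> ^^ k) u) (D v))"

definition anticommutator :: "('a::ab_group_add \<Rightarrow> 'a) \<Rightarrow> ('a \<Rightarrow> 'a) \<Rightarrow> 'a \<Rightarrow> 'a"
  where "anticommutator D1 D2 = (\<lambda>u. (D1 \<circ> D2) u + (D2 \<circ> D1) u)"

end

theory Submission
  imports Defs
begin

text \<open>
  Expanding \<open>D1 (D2 (u \<star> v))\<close> by the two twisted Leibniz rules gives the two terms that the
  Leibniz rule of weight \<open>k + s\<close> asks of \<open>D1 \<circ> D2\<close>, and two cross terms in which each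
  derivation has hit a different factor.  Because derivations commute with the twist, the cross
  terms can be written with all powers of \<open>\<alpha>\<close> on the outside, and in this form they are unchanged,
  up to their order, when \<open>(D1, k)\<close> and \<open>(D2, s)\<close> are exchanged.  In the commutator they cancel;
  in the anti-commutator they add up, so that its failure to satisfy the Leibniz rule is exactly
  twice the expression of the criterion.  Linearity and commutation with \<open>\<alpha>\<close> hold for the
  anti-commutator in any case, and since the characteristic is not two, the doubled expression
  vanishes if and only if the expression itself does.
\<close>

lemma twisted_derivation_commutes_funpow:
  assumes "twisted_derivation scale hmul \<alpha> k D"
  shows "D ((\<alpha> ^^ n) x) = (\<alpha> ^^ n) (D x)"
proof (induction n)
  case (Suc n)
  have "D (\<alpha> y) = \<alpha> (D y)" for y
    using assms unfolding twisted_derivation_def by (metis comp_apply)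
  with Suc show ?case by simp
qed simp

lemma twisted_derivation_Leibniz:
  assumes "twisted_derivation scale hmul \<alpha> k D"
  shows "D (hmul u v) = hmul (D u) ((\<alpha> ^^ k) v) + hmul ((\<alpha> ^^ k) u) (D v)"
  using assms by (simp add: twisted_derivation_def)

lemma twisted_derivation_add:
  assumes "twisted_derivation scale hmul \<alpha> k D"
  shows "D (x + y) = D x + D y"
  using assms unfolding twisted_derivation_def
  by (simp add: Vector_Spaces.linear_iff)

text \<open>
  The bracket on the right collects the cross terms.  It is written with the powers of \<open>\<alpha>\<close>
  outermost to make visible that exchanging the roles of the two derivations only swaps its two
  summands.
\<close>

lemma twisted_derivation_comp_Leibniz:
  assumes D1: "twisted_derivation scale hmul \<alpha> k D1"
    and D2: "twisted_derivation scale hmul \<alpha> s D2"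
  shows "D1 (D2 (hmul u v)) =
    hmul (D1 (D2 u)) ((\<alpha> ^^ (k + s)) v) + hmul ((\<alpha> ^^ (k + s)) u) (D1 (D2 v))
    + (hmul ((\<alpha> ^^ s) (D1 u)) ((\<alpha> ^^ k) (D2 v)) + hmul ((\<alpha> ^^ k) (D2 u)) ((\<alpha> ^^ s) (D1 v)))"
  by (simp add: twisted_derivation_Leibniz[OF D2] twisted_derivation_add[OF D1]
      twisted_derivation_Leibniz[OF D1] twisted_derivation_commutes_funpow[OF D1]
      funpow_add algebra_simps)

lemma anticommutator_Leibniz_defect:
  fixes hmul :: "'a \<Rightarrow> 'a \<Rightarrow> 'a::ab_group_add"
  assumes D1: "twisted_derivation scale hmul \<alpha> k D1"
    and D2: "twisted_derivation scale hmul \<alpha> s D2"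
    and add_left: "\<And>x y z. hmul (x + y) z = hmul x z + hmul y z"
    and add_right: "\<And>x y z. hmul x (y + z) = hmul x y + hmul x z"
  defines "cross u v \<equiv>
    hmul ((\<alpha> ^^ s) (D1 u)) ((\<alpha> ^^ k) (D2 v)) + hmul ((\<alpha> ^^ k) (D2 u)) ((\<alpha> ^^ s) (D1 v))"
  shows "anticommutator D1 D2 (hmul u v) =
    hmul (anticommutator D1 D2 u) ((\<alpha> ^^ (k + s)) v)
    + hmul ((\<alpha> ^^ (k + s)) u) (anticommutator D1 D2 v) + (cross u v + cross u v)"
  using twisted_derivation_comp_Leibniz[OF D1 D2, of u v]
    twisted_derivation_comp_Leibniz[OF D2 D1, of u v]
  by (simp add: anticommutator_def add_left add_right cross_def add.commute[of s k] algebra_simps)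

lemma (in vector_space) double_eq_0_iff:
  fixes x :: 'b
  assumes "(2::'a) \<noteq> 0"
  shows "x + x = 0 \<longleftrightarrow> x = 0"
proof -
  have "x + x = scale 2 x"
    using scale_left_distrib[of 1 1 x] by simp
  with assms show ?thesis by simp
qed

lemma anticommutator_linear:
  assumes "Vector_Spaces.linear scale scale D1" "Vector_Spaces.linear scale scale D2"
  shows "Vector_Spaces.linear scale scale (anticommutator D1 D2)"
proof -
  interpret vector_space_pair scale scale
    using assms(1) by (simp add: Vector_Spaces.linear_iff vector_space_pair_def)
  show ?thesis
    unfolding anticommutator_def
    by (intro linear_compose_add Vector_Spaces.linear_compose[OF assms]
        Vector_Spaces.linear_compose[OF assms(2,1)])
qed

lemma anticommutator_comp_commute:
  assumes "D1 \<circ> \<alpha> = \<alpha> \<circ> D1" "D2 \<circ> \<alpha> = \<alpha> \<circ> D2"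
    and "Vector_Spaces.linear scale scale \<alpha>"
  shows "anticommutator D1 D2 \<circ> \<alpha> = \<alpha> \<circ> anticommutator D1 D2"
proof -
  have "\<alpha> (x + y) = \<alpha> x + \<alpha> y" for x y
    using assms(3) by (simp add: Vector_Spaces.linear_iff)
  with assms(1,2) show ?thesis
    by (simp add: anticommutator_def fun_eq_iff)
qed

theorem proposition3p6:
  fixes scale :: "'k::field \<Rightarrow> 'a::ab_group_add \<Rightarrow> 'a"
    and hmul :: "'a \<Rightarrow> 'a \<Rightarrow> 'a"
    and \<alpha> D1 D2 :: "'a \<Rightarrow> 'a"
    and k s :: nat
  assumes "(2::'k) \<noteq> 0"
    and "hom_jacobi_jordan_algebra scale hmul \<alpha>"
    and "twisted_derivation scale hmul \<alpha> k D1"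
    and "twisted_derivation scale hmul \<alpha> s D2"
  shows "twisted_derivation scale hmul \<alpha> (k + s) (anticommutator D1 D2) \<longleftrightarrow>
    (\<forall>u v. hmul (((\<alpha> ^^ s) \<circ> D1) u) (((\<alpha> ^^ k) \<circ> D2) v)
          + hmul (((\<alpha> ^^ k) \<circ> D2) u) (((\<alpha> ^^ s) \<circ> D1) v) = 0)"
proof -
  interpret hom_jacobi_jordan_algebra scale hmul \<alpha> by fact
  have add_left: "hmul (x + y) z = hmul x z + hmul y z" for x y z
    using linear_prod_left[of z] by (simp add: Vector_Spaces.linear_iff)
  have add_right: "hmul x (y + z) = hmul x y + hmul x z" for x y z
    using linear_prod_right[of x] by (simp add: Vector_Spaces.linear_iff)
  have "Vector_Spaces.linear scale scale (anticommutator D1 D2)"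
    using assms(3,4) anticommutator_linear unfolding twisted_derivation_def by blast
  moreover have "anticommutator D1 D2 \<circ> \<alpha> = \<alpha> \<circ> anticommutator D1 D2"
    using assms(3,4) anticommutator_comp_commute linear_twist
    unfolding twisted_derivation_def by blast
  ultimately show ?thesis
    by (simp add: twisted_derivation_def double_eq_0_iff[OF assms(1)]
        anticommutator_Leibniz_defect[OF assms(3,4) add_left add_right])
qed

end
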